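(* Let $L\ge1$, let $T'_L$ be the block lower triangular matrix with identity diagonal blocks $\mathrm{id}_{N(\ell)}$ and subdiagonal blocks $\mathfrak X_{k\ell}=B_{k\ell}A_\ell^{-1}$ ($k>\ell$), and let $\mathbf f=(f|_{X_1},\dots,f|_{X_L})^T\in\mathbb R^N$ for some $f\in H^\tau(\Omega)$. The Jacobi iteration for the linear system $T'_L\boldsymbol\beta=\mathbf f$, $$\boldsymbol\beta_{m+1}=\mathbf f+(\mathrm{id}-T'_L)\boldsymbol\beta_m,\qquad m\ge0,$$ converges for every starting vector $\boldsymbol\beta_0\in\mathbb R^N$ to the solution in exactly $L$ steps, i.e. $\boldsymbol\beta_L=(T'_L)^{-1}\mathbf f$.
   Context: Kernel: $\Phi:\mathbb R^d\to\mathbb R$ is a radial function with support in the closed unit ball whose Fourier transform satisfies $c_\Phi(1+\|\omega\|_2^2)^{-\tau}\le\widehat\Phi(\omega)\le C_\Phi(1+\|\omega\|_2^2)^{-\tau}$ for some $\tau>d/2$ and $c_\Phi,C_\Phi>0$; in particular $\Phi$ is strictly positive definite. For $\delta>0$ set $\Phi_\delta(x)=\delta^{-d}\Phi(x/\delta)$. Point sets: $\Omega\subset\mathbb R^d$ is a bounded domain with Lipschitz boundary. For $1\le\ell\le L$, $X_\ell=\{x^{(\ell)}_1,\dots,x^{(\ell)}_{N(\ell)}\}\subset\Omega$ is a finite set of $N(\ell)$ distinct points, $\delta_\ell>0$ is a scaling parameter, and $\Phi_\ell:=\Phi_{\delta_\ell}$. $N=\sum_{\ell=1}^LN(\ell)$,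 and $f|_{X_\ell}=(f(x^{(\ell)}_1),\dots,f(x^{(\ell)}_{N(\ell)}))$. Matrices: $B_{k\ell}\in\mathbb R^{N(k)\times N(\ell)}$ has entries $(B_{k\ell})_{ij}=\Phi_\ell(x^{(k)}_i-x^{(\ell)}_j)$; $A_\ell:=B_{\ell\ell}$, which is symmetric positive definite. *)

theory Defs
  imports "HOL-Analysis.Analysis" "Jordan_Normal_Form.Gauss_Jordan_Elimination"
begin

(* Unitary convention.  Only meaningful for integrable f. *)
definition fourier_transform :: "(real ^ 'd \<Rightarrow> real) \<Rightarrow> real ^ 'd \<Rightarrow> complex" where
  "fourier_transform f \<omega> =
     ((2 * pi) powr (- real CARD('d) / 2)) *\<^sub>R
       (LINT x|lebesgue. f x *\<^sub>R exp (- (\<i> * complex_of_real (inner x \<omega>))))"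

definition radial :: "(real ^ 'd \<Rightarrow> real) \<Rightarrow> bool" where
  "radial \<Phi> \<longleftrightarrow> (\<exists>\<phi>. \<forall>x. \<Phi> x = \<phi> (norm x))"

definition scaled_kernel :: "(real ^ 'd \<Rightarrow> real) \<Rightarrow> real \<Rightarrow> real ^ 'd \<Rightarrow> real" where
  "scaled_kernel \<Phi> \<delta> x = \<Phi> (x /\<^sub>R \<delta>) / \<delta> ^ CARD('d)"

(* Near each boundary point, S is the strict epigraph of a Lipschitz function \<gamma> on the
   hyperplane orthogonal to a unit vector e; x - (x \<bullet> e) e is the orthogonal projection
   onto that hyperplane. *)
definition lipschitz_boundary :: "(real ^ 'd) set \<Rightarrow> bool" where
  "lipschitz_boundary S \<longleftrightarrow>
     (\<forall>p \<in> frontier S. \<exists>U e \<gamma> K. open U \<and> p \<in> U \<and> norm e = 1 \<and>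
        K-lipschitz_on {y. inner y e = 0} (\<gamma> :: real ^ 'd \<Rightarrow> real) \<and>
        (\<forall>x \<in> U. x \<in> S \<longleftrightarrow> \<gamma> (x - inner x e *\<^sub>R e) < inner x e))"

definition bounded_lipschitz_domain :: "(real ^ 'd) set \<Rightarrow> bool" where
  "bounded_lipschitz_domain S \<longleftrightarrow>
     open S \<and> connected S \<and> S \<noteq> {} \<and> bounded S \<and> lipschitz_boundary S"

definition square_integrable :: "(real ^ 'd \<Rightarrow> 'b::euclidean_space) \<Rightarrow> bool" where
  "square_integrable f \<longleftrightarrow>
     f \<in> borel_measurable lebesgue \<and> integrable lebesgue (\<lambda>x. (norm (f x))\<^sup>2)"

(* g represents the Fourier-Plancherel transform of the square integrable function f: it is
   the L2 limit of the transforms of the (integrable) truncations of f to balls. *)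
definition plancherel_transform :: "(real ^ 'd \<Rightarrow> real) \<Rightarrow> (real ^ 'd \<Rightarrow> complex) \<Rightarrow> bool" where
  "plancherel_transform f g \<longleftrightarrow>
     square_integrable g \<and>
     (\<lambda>n. \<integral>\<^sup>+ \<omega>. ennreal ((norm (fourier_transform (\<lambda>x. indicator (cball 0 (real n)) x * f x) \<omega>
              - g \<omega>))\<^sup>2) \<partial>lebesgue) \<longlonglongrightarrow> 0"

definition sobolev_space_whole :: "real \<Rightarrow> (real ^ 'd \<Rightarrow> real) set" where
  "sobolev_space_whole \<tau> =
     {f. square_integrable f \<and>
         (\<exists>g. plancherel_transform f g \<and>
              integrable lebesgue (\<lambda>\<omega>. (1 + (norm \<omega>)\<^sup>2) powr \<tau> * (norm (g \<omega>))\<^sup>2))}"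

(* Restrictions to S of whole-space functions, up to equality almost everywhere; values
   outside S are irrelevant. *)
definition sobolev_space :: "real \<Rightarrow> (real ^ 'd) set \<Rightarrow> (real ^ 'd \<Rightarrow> real) set" where
  "sobolev_space \<tau> S =
     {f. \<exists>F \<in> sobolev_space_whole \<tau>. AE x in lebesgue. x \<in> S \<longrightarrow> f x = F x}"

(* mat_inverse yields the two-sided inverse whenever there is one. *)
definition matrix_inverse :: "real mat \<Rightarrow> real mat" where
  "matrix_inverse A = the (mat_inverse A)"

(* B_{kl}; rows and columns are indexed from 0. *)
definition kernel_matrix ::
  "(real ^ 'd \<Rightarrow> real) \<Rightarrow> (nat \<Rightarrow> real) \<Rightarrow> (nat \<Rightarrow> nat) \<Rightarrow> (nat \<Rightarrow> nat \<Rightarrow> real ^ 'd) \<Rightarrow>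
     nat \<Rightarrow> nat \<Rightarrow> real mat" where
  "kernel_matrix \<Phi> \<delta> N x k l =
     Matrix.mat (N k) (N l) (\<lambda>(i, j). scaled_kernel \<Phi> (\<delta> l) (x k i - x l j))"

definition total_size :: "nat \<Rightarrow> (nat \<Rightarrow> nat) \<Rightarrow> nat" where
  "total_size L N = (\<Sum>l = 1..L. N l)"

(* Position a of a vector partitioned into blocks 1, ..., L of sizes N 1, ..., N L is entry i
   of block k, where (k, i) = block_indices L N ! a. *)
definition block_indices :: "nat \<Rightarrow> (nat \<Rightarrow> nat) \<Rightarrow> (nat \<times> nat) list" where
  "block_indices L N = [(k, i). k \<leftarrow> [1..<Suc L], i \<leftarrow> [0..<N k]]"

lemma length_block_indices: "length (block_indices L N) = total_size L N"
  unfolding block_indices_def total_size_def by (induction L) auto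

definition block_matrix :: "nat \<Rightarrow> (nat \<Rightarrow> nat) \<Rightarrow> (nat \<Rightarrow> nat \<Rightarrow> real mat) \<Rightarrow> real mat" where
  "block_matrix L N M =
     Matrix.mat (total_size L N) (total_size L N)
       (\<lambda>(a, b). case block_indices L N ! a of (k, i) \<Rightarrow>
          case block_indices L N ! b of (l, j) \<Rightarrow> M k l $$ (i, j))"

definition block_vector :: "nat \<Rightarrow> (nat \<Rightarrow> nat) \<Rightarrow> (nat \<Rightarrow> real Matrix.vec) \<Rightarrow> real Matrix.vec" where
  "block_vector L N v =
     Matrix.vec (total_size L N)
       (\<lambda>a. case block_indices L N ! a of (k, i) \<Rightarrow> vec_index (v k) i)"

definition multilevel_matrix ::
  "nat \<Rightarrow> (real ^ 'd \<Rightarrow> real) \<Rightarrow> (nat \<Rightarrow> real) \<Rightarrow> (nat \<Rightarrow> nat) \<Rightarrow> (nat \<Rightarrow> nat \<Rightarrow> real ^ 'd) \<Rightarrow>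
     real mat" where
  "multilevel_matrix L \<Phi> \<delta> N x =
     block_matrix L N (\<lambda>k l.
       if k = l then 1\<^sub>m (N l)
       else if l < k then
         kernel_matrix \<Phi> \<delta> N x k l * matrix_inverse (kernel_matrix \<Phi> \<delta> N x l l)
       else 0\<^sub>m (N k) (N l))"

definition sample_vector ::
  "nat \<Rightarrow> (nat \<Rightarrow> nat) \<Rightarrow> (nat \<Rightarrow> nat \<Rightarrow> real ^ 'd) \<Rightarrow> (real ^ 'd \<Rightarrow> real) \<Rightarrow> real Matrix.vec" where
  "sample_vector L N x f = block_vector L N (\<lambda>l. Matrix.vec (N l) (\<lambda>i. f (x l i)))"

end

theory Submission
  imports Defs "Jordan_Normal_Form.Determinant"
begin

text \<open>
  Assign to each index of a vector the number of the block that contains it.  Since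
  \<open>E = id - T\<close> is strictly block lower triangular, entry \<open>a\<close> of \<open>E v\<close> only depends on the entries
  of \<open>v\<close> in blocks of smaller number; if \<open>v\<close> vanishes on the blocks \<open>1, \<dots>, k\<close>, then \<open>E v\<close>
  vanishes on the blocks \<open>1, \<dots>, k + 1\<close>.  A kernel vector of \<open>T\<close> satisfies \<open>v = E v\<close> and is
  therefore zero, so \<open>T\<close> is invertible.  The errors of the iteration satisfy
  \<open>e\<^sub>m\<^sub>+\<^sub>1 = E e\<^sub>m\<close>, hence vanish from \<open>m = L\<close> on.
\<close>

text \<open>The function \<open>lev\<close> stands for the block number of an index, so block
  triangularity is expressed entrywise, without cutting out submatrices. Equal levels are included:
  the diagonal blocks vanish as well, which is what makes \<open>E\<close> nilpotent.\<close>

definition strictly_lower_wrt :: "(nat \<Rightarrow> nat) \<Rightarrow> 'a :: zero mat \<Rightarrow> bool" where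
  "strictly_lower_wrt lev E \<longleftrightarrow>
     (\<forall>a < dim_row E. \<forall>b < dim_col E. lev a \<le> lev b \<longrightarrow> E $$ (a, b) = 0)"

definition vanishes_upto :: "(nat \<Rightarrow> nat) \<Rightarrow> nat \<Rightarrow> 'a :: zero Matrix.vec \<Rightarrow> bool" where
  "vanishes_upto lev k v \<longleftrightarrow> (\<forall>a < dim_vec v. lev a \<le> k \<longrightarrow> vec_index v a = 0)"

lemma vanishes_upto_mult:
  fixes E :: "'a :: semiring_0 mat"
  assumes E: "E \<in> carrier_mat n n" "strictly_lower_wrt lev E"
    and v: "v \<in> carrier_vec n" "vanishes_upto lev k v"
  shows "vanishes_upto lev (Suc k) (E *\<^sub>v v)"
  unfolding vanishes_upto_def
proof (intro allI impI)
  fix a assume a: "a < dim_vec (E *\<^sub>v v)" "lev a \<le> Suc k"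
  \<comment> \<open>One of the two factors is zero: if \<open>E\<close> may be nonzero at
    \<open>(a, b)\<close>, then \<open>lev b < lev a \<le> Suc k\<close>, so
    \<open>lev b \<le> k\<close> and \<open>v\<close> vanishes at \<open>b\<close>.\<close>
  have "E $$ (a, b) * vec_index v b = 0" if "b < n" for b
  proof (cases "lev a \<le> lev b")
    case True
    then show ?thesis using E a that by (auto simp: strictly_lower_wrt_def)
  next
    case False
    then show ?thesis using v a that by (auto simp: vanishes_upto_def)
  qed
  then show "vec_index (E *\<^sub>v v) a = 0"
    using E v a by (auto simp: scalar_prod_def intro!: sum.neutral)
qed

lemma vanishes_upto_imp_zero:
  assumes "v \<in> carrier_vec n" "vanishes_upto lev k v" "\<And>a. a < n \<Longrightarrow> lev a \<le> k"
  shows "v = 0\<^sub>v n"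
  using assms by (intro eq_vecI) (auto simp: vanishes_upto_def)

text \<open>Every application of \<open>E\<close> clears one more level, and \<open>L\<close> levels
  exhaust all indices. Phrasing this for a recursive sequence instead of powers of \<open>E\<close>
  serves both kernel vectors and iteration errors.\<close>

lemma strictly_lower_iterates_vanish:
  fixes E :: "'a :: semiring_0 mat"
  assumes E: "E \<in> carrier_mat n n" "strictly_lower_wrt lev E"
    and lev: "\<And>a. a < n \<Longrightarrow> 1 \<le> lev a \<and> lev a \<le> L"
    and e: "e 0 \<in> carrier_vec n" "\<And>m. e (Suc m) = E *\<^sub>v e m"
    and m: "m \<ge> L"
  shows "e m = 0\<^sub>v n"
proof -
  have "e m \<in> carrier_vec n \<and> vanishes_upto lev m (e m)" for m
  proof (induction m)
    case 0
    \<comment> \<open>Levels start at 1, so the claim for \<open>m = 0\<close> is vacuous; this is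
      why exactly \<open>L\<close> steps suffice.\<close>
    have "\<not> lev a \<le> 0" if "a < dim_vec (e 0)" for a
      using lev[of a] that e(1) by auto
    then show ?case using e(1) unfolding vanishes_upto_def by blast
  next
    case (Suc m)
    then show ?case using vanishes_upto_mult[OF E] E by (simp add: e(2))
  qed
  then show ?thesis
    using vanishes_upto_imp_zero lev m le_trans by metis
qed

lemma one_minus_mult_vec:
  fixes T :: "'a :: comm_ring_1 mat"
  assumes "T \<in> carrier_mat n n" "v \<in> carrier_vec n"
  shows "(1\<^sub>m n - T) *\<^sub>v v = v - T *\<^sub>v v"
  using assms minus_mult_distrib_mat_vec[of "1\<^sub>m n" n n T v] by simp

lemma det_unit_lower_nonzero:
  fixes T :: "'a :: field mat"
  assumes T: "T \<in> carrier_mat n n" "strictly_lower_wrt lev (1\<^sub>m n - T)"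
    and lev: "\<And>a. a < n \<Longrightarrow> 1 \<le> lev a \<and> lev a \<le> L"
  shows "Determinant.det T \<noteq> 0"
proof
  assume "Determinant.det T = 0"
  then obtain v where v: "v \<in> carrier_vec n" "v \<noteq> 0\<^sub>v n" "T *\<^sub>v v = 0\<^sub>v n"
    using det_0_iff_vec_prod_zero_field[OF T(1)] by auto
  have "v = (1\<^sub>m n - T) *\<^sub>v v"
    using v one_minus_mult_vec[OF T(1) v(1)] by simp
  moreover have "1\<^sub>m n - T \<in> carrier_mat n n" using T by auto
  \<comment> \<open>As a fixed point of \<open>1\<^sub>m n - T\<close>, the vector \<open>v\<close>
    forms a constant sequence that obeys the recursion.\<close>
  ultimately have "v = 0\<^sub>v n"
    using strictly_lower_iterates_vanish[of "1\<^sub>m n - T" n lev L "\<lambda>_. v" L] T lev v by auto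
  then show False using v by simp
qed

text \<open>A nonzero determinant makes \<open>T\<close> a unit of the matrix ring. This excludes
  the result \<open>None\<close> of \<open>mat_inverse\<close>, so \<open>the\<close> yields a
  genuine inverse.\<close>

lemma matrix_inverse_mult:
  assumes T: "T \<in> carrier_mat n n" "Determinant.det T \<noteq> 0"
  shows "matrix_inverse T \<in> carrier_mat n n"
    and "T * matrix_inverse T = 1\<^sub>m n" and "matrix_inverse T * T = 1\<^sub>m n"
proof -
  have "T \<in> Units (ring_mat TYPE(real) n ())"
    using det_non_zero_imp_unit[OF T] .
  then obtain S where "mat_inverse T = Some S"
    using mat_inverse(1)[OF T(1), of "()"] by (cases "mat_inverse T") auto
  then show "matrix_inverse T \<in> carrier_mat n n" "T * matrix_inverse T = 1\<^sub>m n"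
    "matrix_inverse T * T = 1\<^sub>m n"
    using mat_inverse(2)[OF T(1)] by (auto simp: matrix_inverse_def)
qed

lemma jacobi_unit_lower_terminates:
  fixes T :: "real mat"
  assumes T: "T \<in> carrier_mat n n" "strictly_lower_wrt lev (1\<^sub>m n - T)"
    and lev: "\<And>a. a < n \<Longrightarrow> 1 \<le> lev a \<and> lev a \<le> L"
    and g: "g \<in> carrier_vec n"
    and \<beta>: "\<beta> 0 \<in> carrier_vec n" "\<And>m. \<beta> (Suc m) = g + (1\<^sub>m n - T) *\<^sub>v \<beta> m"
    and m: "m \<ge> L"
  shows "\<beta> m = matrix_inverse T *\<^sub>v g"
proof -
  let ?E = "1\<^sub>m n - T"
  define s where "s = matrix_inverse T *\<^sub>v g"
  note inv = matrix_inverse_mult[OF T(1) det_unit_lower_nonzero[OF T lev]]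
  have E: "?E \<in> carrier_mat n n" using T by auto
  have s: "s \<in> carrier_vec n" using inv g by (auto simp: s_def)
  have "T *\<^sub>v s = g"
    unfolding s_def using assoc_mult_mat_vec[OF T(1) inv(1) g] inv g by simp
  \<comment> \<open>Thus \<open>s\<close> is a fixed point of the iteration, and subtracting it from
    both sides of the recursion removes \<open>g\<close>.\<close>
  then have Es: "?E *\<^sub>v s = s - g" using one_minus_mult_vec[OF T(1) s] by simp
  have \<beta>_carrier: "\<beta> k \<in> carrier_vec n" for k
    by (induction k) (use \<beta> E g in auto)
  have step: "\<beta> (Suc k) - s = ?E *\<^sub>v (\<beta> k - s)" for k
  proof -
    have "?E *\<^sub>v (\<beta> k - s) = ?E *\<^sub>v \<beta> k - (s - g)"
      using mult_minus_distrib_mat_vec[OF E \<beta>_carrier s] Es by simp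
    also have "\<dots> = \<beta> (Suc k) - s"
      unfolding \<beta>(2) using E g s \<beta>_carrier[of k] by (intro eq_vecI) auto
    finally show ?thesis by simp
  qed
  have "\<beta> m - s = 0\<^sub>v n"
    by (rule strictly_lower_iterates_vanish[where e = "\<lambda>k. \<beta> k - s", OF E T(2) lev _ step m])
      (use \<beta>(1) s in auto)
  then have "vec_index (\<beta> m) a - vec_index s a = 0" if "a < n" for a
    using that s \<beta>_carrier[of m] by (metis carrier_vecD index_minus_vec(1) index_zero_vec(1))
  then have "\<beta> m = s"
    using s \<beta>_carrier[of m] by (intro eq_vecI) auto
  then show ?thesis by (simp add: s_def)
qed

text \<open>Different positions have different pairs of block and entry, so the ones of the global
  identity matrix match those of the identity blocks.\<close>

lemma distinct_block_indices: "distinct (block_indices L N)"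
  unfolding block_indices_def
  by (induction L) (auto simp: distinct_map inj_on_def)

lemma block_indices_nth:
  assumes "a < total_size L N"
  shows "fst (block_indices L N ! a) \<in> {1..L}"
    and "snd (block_indices L N ! a) < N (fst (block_indices L N ! a))"
proof -
  have "block_indices L N ! a \<in> set (block_indices L N)"
    using assms by (simp add: length_block_indices)
  then show "fst (block_indices L N ! a) \<in> {1..L}"
    "snd (block_indices L N ! a) < N (fst (block_indices L N ! a))"
    by (auto simp: block_indices_def)
qed

lemma block_matrix_strictly_lower:
  fixes M :: "nat \<Rightarrow> nat \<Rightarrow> real mat"
  assumes diag: "\<And>k. M k k = 1\<^sub>m (N k)"
    and upper: "\<And>k l. k < l \<Longrightarrow> M k l = 0\<^sub>m (N k) (N l)"
  shows "strictly_lower_wrt (\<lambda>a. fst (block_indices L N ! a))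
           (1\<^sub>m (total_size L N) - block_matrix L N M)"
  unfolding strictly_lower_wrt_def
proof (intro allI impI)
  fix a b
  let ?I = "block_indices L N" and ?n = "total_size L N"
  assume "a < dim_row (1\<^sub>m ?n - block_matrix L N M)" "b < dim_col (1\<^sub>m ?n - block_matrix L N M)"
    and le: "fst (?I ! a) \<le> fst (?I ! b)"
  then have ab: "a < ?n" "b < ?n" by (auto simp: block_matrix_def)
  obtain k i l j where kl: "?I ! a = (k, i)" "?I ! b = (l, j)" by fastforce
  \<comment> \<open>These bounds keep \<open>(i, j)\<close> inside the block, where the entries of
    \<open>1\<^sub>m\<close> and \<open>0\<^sub>m\<close> are determined.\<close>
  have ij: "i < N k" "j < N l"
    using block_indices_nth(2)[OF ab(1)] block_indices_nth(2)[OF ab(2)] kl by auto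
  have eq: "a = b \<longleftrightarrow> (k, i) = (l, j)"
    using nth_eq_iff_index_eq[OF distinct_block_indices, of a L N b] ab kl
    by (simp add: length_block_indices)
  \<comment> \<open>By \<open>le\<close> only \<open>k = l\<close> and \<open>k < l\<close> occur.
    In an identity block, \<open>i = j\<close> means \<open>a = b\<close>; in a zero block,
    \<open>k \<noteq> l\<close> forces \<open>a \<noteq> b\<close>.\<close>
  have "M k l $$ (i, j) = (if a = b then 1 else 0)"
    using le kl ij eq diag upper[of k l] by (cases "k = l") auto
  then show "(1\<^sub>m ?n - block_matrix L N M) $$ (a, b) = 0"
    using ab kl by (auto simp: block_matrix_def)
qed

theorem theorem11:
  fixes \<Phi> :: "real ^ 'd \<Rightarrow> real"
    and \<tau> c C :: real
    and \<Omega> :: "(real ^ 'd) set"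
    and L :: nat
    and N :: "nat \<Rightarrow> nat"
    and x :: "nat \<Rightarrow> nat \<Rightarrow> real ^ 'd"
    and \<delta> :: "nat \<Rightarrow> real"
    and f :: "real ^ 'd \<Rightarrow> real"
    and \<beta> :: "nat \<Rightarrow> real Matrix.vec"
  assumes "continuous_on UNIV \<Phi>"
    and "radial \<Phi>"
    and "closure {y. \<Phi> y \<noteq> 0} \<subseteq> cball 0 1"
    and "\<tau> > real CARD('d) / 2"
    and "c > 0" and "C > 0"
    and "\<And>\<omega>. fourier_transform \<Phi> \<omega> \<in> \<real>"
    and "\<And>\<omega>. c * (1 + (norm \<omega>)\<^sup>2) powr (- \<tau>) \<le> Re (fourier_transform \<Phi> \<omega>)"
    and "\<And>\<omega>. Re (fourier_transform \<Phi> \<omega>) \<le> C * (1 + (norm \<omega>)\<^sup>2) powr (- \<tau>)"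
    and "bounded_lipschitz_domain \<Omega>"
    and "L \<ge> 1"
    and "\<And>l. l \<in> {1..L} \<Longrightarrow> inj_on (x l) {..<N l}"
    and "\<And>l. l \<in> {1..L} \<Longrightarrow> x l ` {..<N l} \<subseteq> \<Omega>"
    and "\<And>l. l \<in> {1..L} \<Longrightarrow> \<delta> l > 0"
    and "f \<in> sobolev_space \<tau> \<Omega>"
    and "continuous_on \<Omega> f"
    and "\<beta> 0 \<in> carrier_vec (total_size L N)"
    and "\<And>m. \<beta> (Suc m) = sample_vector L N x f +
           (1\<^sub>m (total_size L N) - multilevel_matrix L \<Phi> \<delta> N x) *\<^sub>v \<beta> m"
  shows "invertible_mat (multilevel_matrix L \<Phi> \<delta> N x) \<and>
         \<beta> L = matrix_inverse (multilevel_matrix L \<Phi> \<delta> N x) *\<^sub>v sample_vector L N x f \<and>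
         (\<forall>m \<ge> L. \<beta> m = \<beta> L)"
proof -
  let ?n = "total_size L N" and ?lev = "\<lambda>a. fst (block_indices L N ! a)"
  let ?T = "multilevel_matrix L \<Phi> \<delta> N x" and ?g = "sample_vector L N x f"
  have T: "?T \<in> carrier_mat ?n ?n"
    by (simp add: multilevel_matrix_def block_matrix_def)
  have low: "strictly_lower_wrt ?lev (1\<^sub>m ?n - ?T)"
    unfolding multilevel_matrix_def by (rule block_matrix_strictly_lower) auto
  have lev: "1 \<le> ?lev a \<and> ?lev a \<le> L" if "a < ?n" for a
    using block_indices_nth(1)[OF that] by auto
  have g: "?g \<in> carrier_vec ?n"
    by (simp add: sample_vector_def block_vector_def)
  note inv = matrix_inverse_mult[OF T det_unit_lower_nonzero[OF T low lev]]
  have "invertible_mat ?T"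
    using T inv unfolding invertible_mat_def inverts_mat_def square_mat.simps
    by (intro conjI exI[of _ "matrix_inverse ?T"]) auto
  \<comment> \<open>Taking all \<open>m \<ge> L\<close> at once gives both the value at
    \<open>L\<close> and the stationarity afterwards.\<close>
  moreover have "\<beta> m = matrix_inverse ?T *\<^sub>v ?g" if "m \<ge> L" for m
    using jacobi_unit_lower_terminates[where \<beta> = \<beta>, OF T low lev g assms(17,18) that] .
  ultimately show ?thesis by auto
qed

end
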